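(* Let $r\ge 2$, $t\ge 1$, $k\ge 2$ and $n$ be integers. If $G$ is a $K_k$-free blue-red graph on $n$ vertices, then $$\mathcal{N}(K_r,G_{blue})+t|E(G_{red})|+(t-1)\left(\binom{n}{2}-|E(G)|\right)\le (t-1)\binom{n}{2}+\max\{ex(n,K_r,K_k)-(t-1)ex(n,K_k),\ ex(n,K_k)\}.$$
   Context: A blue-red graph is a simple graph each of whose edges is colored blue or red; $G_{blue}$ and $G_{red}$ are the spanning subgraphs formed by the blue and the red edges, and $E(G)$ is the set of all edges. $\mathcal{N}(H,G)$ denotes the number of copies of $H$ in $G$. $ex(n,F)$ is the maximum number of edges of an $F$-free graph on $n$ vertices, and $ex(n,H,F)$ is the maximum of $\mathcal{N}(H,G)$ over $F$-free graphs $G$ on $n$ vertices. *)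

theory Defs
  imports Complex_Main
begin

record 'v graph =
  verts :: "'v set"
  edges :: "'v set set"

definition simple_graph :: "'v graph \<Rightarrow> bool" where
  "simple_graph G \<longleftrightarrow>
     finite (verts G) \<and> edges G \<subseteq> {e. e \<subseteq> verts G \<and> card e = 2}"

definition subgraph :: "'v graph \<Rightarrow> 'v graph \<Rightarrow> bool" where
  "subgraph S G \<longleftrightarrow>
     simple_graph S \<and> verts S \<subseteq> verts G \<and> edges S \<subseteq> edges G"

definition graph_iso :: "'u graph \<Rightarrow> 'v graph \<Rightarrow> bool" where
  "graph_iso H G \<longleftrightarrow>
     (\<exists>f. bij_betw f (verts H) (verts G) \<and> edges G = (\<lambda>e. f ` e) ` edges H)"

(* A copy is a subgraph, not necessarily induced; embeddings with the same image
   are counted once. *)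
definition copies :: "'u graph \<Rightarrow> 'v graph \<Rightarrow> 'v graph set" where
  "copies H G = {S. subgraph S G \<and> graph_iso H S}"

definition num_copies :: "'u graph \<Rightarrow> 'v graph \<Rightarrow> nat" where
  "num_copies H G = card (copies H G)"

definition graph_free :: "'u graph \<Rightarrow> 'v graph \<Rightarrow> bool" where
  "graph_free F G \<longleftrightarrow> copies F G = {}"

definition complete_graph :: "nat \<Rightarrow> nat graph" where
  "complete_graph m = \<lparr>verts = {..<m}, edges = {e. e \<subseteq> {..<m} \<and> card e = 2}\<rparr>"

(* Every finite graph is isomorphic to one with vertices in nat, so the extremal numbers
   need only range over such graphs. The sets below are always finite; they are nonempty
   for F = complete_graph k with k \<ge> 2, since the edgeless graph is then F-free. *)
definition ex_num :: "nat \<Rightarrow> 'u graph \<Rightarrow> nat" where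
  "ex_num n F =
     Max {card (edges G) | G :: nat graph.
            simple_graph G \<and> card (verts G) = n \<and> graph_free F G}"

definition gen_ex_num :: "nat \<Rightarrow> 'w graph \<Rightarrow> 'u graph \<Rightarrow> nat" where
  "gen_ex_num n H F =
     Max {num_copies H G | G :: nat graph.
            simple_graph G \<and> card (verts G) = n \<and> graph_free F G}"

datatype colour = Blue | Red

(* A blue-red graph is a simple graph G together with a colouring c; the values of c
   outside edges G are irrelevant. *)
definition colour_graph :: "'v graph \<Rightarrow> ('v set \<Rightarrow> colour) \<Rightarrow> colour \<Rightarrow> 'v graph" where
  "colour_graph G c x = \<lparr>verts = verts G, edges = {e \<in> edges G. c e = x}\<rparr>"

end

theory Submission
  imports Defs "HOL-Library.FuncSet"
begin

text \<open>
  Blow up a coloured clique on at most \<open>k - 1\<close> vertices by integer vertex weights \<open>x\<close>.  The number of blue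
  copies of \<open>K\<^sub>r\<close>, plus the number of red edges, minus \<open>t - 1\<close> times the number of blue edges of the blow-up
  is a multilinear form in \<open>x\<close>.
  For non-adjacent vertices this form has no mixed term, so all weight of one of them can be moved to
  the other without loss, as in the Motzkin--Straus argument; hence every \<open>K\<^sub>k\<close>-free graph is beaten by a blow-up.

  Take an optimal blow-up with as many red pairs as possible.  Since no blue pair can be recoloured red, the
  coefficient of \<open>x\<^sub>i x\<^sub>l\<close> exceeds \<open>1\<close> for each blue pair.  If \<open>i\<close> had a blue neighbour \<open>l\<close> and a red neighbour \<open>j\<close>,
  then giving \<open>j\<close> the colours of \<open>i\<close> and making the pair \<open>ij\<close> blue would be a strict improvement.
  So the optimum is monochromatic.  A red one has at most \<open>ex(n, K\<^sub>k)\<close> edges.  A blue one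
  is balanced, because shifting a unit of weight from a large to a small part has positive effect
  (unless all weight sits on one vertex, where the form vanishes), so it has exactly \<open>ex(n, K\<^sub>k)\<close> edges and at most \<open>ex(n, K\<^sub>r, K\<^sub>k)\<close> copies of \<open>K\<^sub>r\<close>.
\<close>

subsection \<open>Multilinear forms\<close>

text \<open>For nonnegative integers \<open>x\<close>, the monomial \<open>prod x S\<close> counts
  the transversals of the classes in \<open>S\<close> when each \<open>i\<close> is blown up to
  \<open>x i\<close> vertices. The form is affine in each variable, which drives all shifting
  arguments.\<close>

definition multilin :: "'a set \<Rightarrow> ('a set \<Rightarrow> int) \<Rightarrow> ('a \<Rightarrow> int) \<Rightarrow> int" where
  "multilin P a x = (\<Sum>S\<in>Pow P. a S * (\<Prod>i\<in>S. x i))"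

text \<open>Every monomial that leaves the support of \<open>x\<close> vanishes, so coefficients
  there may differ. This makes colours at weightless vertices irrelevant.\<close>

lemma multilin_cong:
  assumes "\<And>S. S \<subseteq> P \<Longrightarrow> (\<And>i. i \<in> S \<Longrightarrow> x i \<noteq> 0) \<Longrightarrow> a S = b S" and "\<And>i. i \<in> P \<Longrightarrow> x i = y i"
    and "finite P"
  shows "multilin P a x = multilin P b y"
  unfolding multilin_def
proof (rule sum.cong)
  fix S assume "S \<in> Pow P"
  then have S: "S \<subseteq> P" "finite S" using assms(3) finite_subset by auto
  have p: "prod x S = prod y S" using S assms(2) by (intro prod.cong) auto
  show "a S * prod x S = b S * prod y S"
  proof (cases "\<exists>i\<in>S. x i = 0")
    case True
    then have "prod x S = 0" using S by auto
    then show ?thesis using p by simp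
  next
    case False
    then show ?thesis using assms(1)[of S] S p by auto
  qed
qed simp

lemma multilin_add: "multilin P (\<lambda>S. a S + b S) x = multilin P a x + multilin P b x"
  by (simp add: multilin_def sum.distrib algebra_simps)

lemma multilin_cmult: "multilin P (\<lambda>S. k * a S) x = k * multilin P a x"
  by (simp add: multilin_def sum_distrib_left algebra_simps)

lemma multilin_insert:
  assumes "finite P" "i \<notin> P"
  shows "multilin (insert i P) a x = multilin P a x + x i * multilin P (\<lambda>S. a (insert i S)) x"
proof -
  have inj: "inj_on (insert i) (Pow P)" using assms(2) by (auto simp: inj_on_def)
  have "(\<Sum>S\<in>insert i ` Pow P. a S * prod x S) = (\<Sum>S\<in>Pow P. a (insert i S) * prod x (insert i S))"
    using inj by (simp add: sum.reindex)
  also have "\<dots> = (\<Sum>S\<in>Pow P. x i * (a (insert i S) * prod x S))"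
  proof (rule sum.cong)
    fix S assume "S \<in> Pow P"
    then have "finite S" "i \<notin> S" using assms finite_subset by auto
    then show "a (insert i S) * prod x (insert i S) = x i * (a (insert i S) * prod x S)" by simp
  qed simp
  finally have *: "(\<Sum>S\<in>insert i ` Pow P. a S * prod x S) = \<dots>" .
  have "(\<Sum>S\<in>Pow P \<union> insert i ` Pow P. a S * prod x S)
      = (\<Sum>S\<in>Pow P. a S * prod x S) + (\<Sum>S\<in>insert i ` Pow P. a S * prod x S)"
    using assms by (intro sum.union_disjoint) auto
  then show ?thesis using *
    by (simp add: multilin_def Pow_insert sum_distrib_left)
qed

text \<open>Splits off \<open>i\<close> and \<open>j\<close> by \<open>multilin_insert\<close>. The
  four remaining forms do not see the values at \<open>i\<close> and \<open>j\<close>, so they can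
  be evaluated at \<open>x\<close> while \<open>y\<close> moves weight within the pair.\<close>

lemma multilin_pair:
  assumes "finite P" "i \<in> P" "j \<in> P" "i \<noteq> j" "\<And>l. l \<in> P - {i, j} \<Longrightarrow> y l = x l"
  shows "multilin P a y = multilin (P - {i, j}) a x
           + y i * multilin (P - {i, j}) (\<lambda>S. a (insert i S)) x
           + y j * multilin (P - {i, j}) (\<lambda>S. a (insert j S)) x
           + y i * y j * multilin (P - {i, j}) (\<lambda>S. a (insert i (insert j S))) x"
proof -
  let ?Q = "P - {i, j}"
  have P: "P = insert j (insert i ?Q)" using assms by auto
  have eq: "multilin ?Q b y = multilin ?Q b x" for b
    using assms by (intro multilin_cong) auto
  have "multilin (insert j (insert i ?Q)) a y = multilin (insert i ?Q) a y
          + y j * multilin (insert i ?Q) (\<lambda>S. a (insert j S)) y"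
    using assms by (intro multilin_insert) auto
  moreover have "multilin (insert i ?Q) b y = multilin ?Q b y + y i * multilin ?Q (\<lambda>S. b (insert i S)) y" for b
    using assms by (intro multilin_insert) auto
  ultimately have "multilin (insert j (insert i ?Q)) a y = multilin ?Q a x
          + y i * multilin ?Q (\<lambda>S. a (insert i S)) x + y j * (multilin ?Q (\<lambda>S. a (insert j S)) x
          + y i * multilin ?Q (\<lambda>S. a (insert j (insert i S))) x)"
    by (simp only: eq)
  then show ?thesis using P by (simp add: algebra_simps insert_commute)
qed

text \<open>Serves to compare clique counts through different pairs, whose ground sets differ:
  monomials of \<open>A\<close> leaving \<open>B\<close> vanish, common ones are dominated, and the
  extra ones of \<open>B\<close> are nonnegative.\<close>

lemma multilin_le:
  assumes "finite A" "finite B"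
    and "\<And>S. S \<subseteq> A \<Longrightarrow> \<not> S \<subseteq> B \<Longrightarrow> a S * prod x S = 0"
    and "\<And>S. S \<subseteq> A \<Longrightarrow> S \<subseteq> B \<Longrightarrow> a S \<le> b S"
    and "\<And>S. S \<subseteq> B \<Longrightarrow> 0 \<le> b S" and "\<And>i. i \<in> B \<Longrightarrow> 0 \<le> x i"
  shows "multilin A a x \<le> multilin B b x"
proof -
  have "multilin A a x = (\<Sum>S\<in>Pow (A \<inter> B). a S * prod x S)"
    unfolding multilin_def using assms(1-3) by (intro sum.mono_neutral_right) auto
  also have "\<dots> \<le> (\<Sum>S\<in>Pow (A \<inter> B). b S * prod x S)"
    using assms(4,6) by (intro sum_mono mult_right_mono prod_nonneg) auto
  also have "\<dots> \<le> multilin B b x"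
    unfolding multilin_def using assms(2,5,6) by (intro sum_mono2 mult_nonneg_nonneg prod_nonneg) auto
  finally show ?thesis .
qed

lemma multilin_reindex:
  assumes "inj_on g P"
  shows "multilin (g ` P) a x = multilin P (\<lambda>S. a (g ` S)) (x \<circ> g)"
proof -
  have "inj_on ((`) g) (Pow P)" using assms by (rule inj_on_image_Pow)
  moreover have "Pow (g ` P) = (`) g ` Pow P" by (rule image_Pow_surj[OF refl, symmetric])
  ultimately have "multilin (g ` P) a x = (\<Sum>S\<in>Pow P. a (g ` S) * prod x (g ` S))"
    by (simp add: multilin_def sum.reindex)
  also have "\<dots> = multilin P (\<lambda>S. a (g ` S)) (x \<circ> g)"
    unfolding multilin_def
  proof (rule sum.cong)
    fix S assume "S \<in> Pow P"
    then have "inj_on g S" using assms inj_on_subset by auto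
    then show "a (g ` S) * prod x (g ` S) = a (g ` S) * prod (x \<circ> g) S"
      by (simp add: prod.reindex)
  qed simp
  finally show ?thesis .
qed

lemma multilin_superset:
  assumes "finite P" "Q \<subseteq> P" "\<And>i. i \<in> P - Q \<Longrightarrow> x i = 0"
  shows "multilin P a x = multilin Q a x"
  unfolding multilin_def
proof (rule sum.mono_neutral_right)
  show "\<forall>S\<in>Pow P - Pow Q. a S * prod x S = 0"
  proof
    fix S assume "S \<in> Pow P - Pow Q"
    then obtain i where "i \<in> S" "i \<in> P - Q" "finite S" using assms(1) finite_subset by auto
    then show "a S * prod x S = 0" using assms(3) by auto
  qed
qed (use assms in auto)

lemma multilin_delta:
  assumes "finite P"
  shows "multilin P (\<lambda>S. if S = {} then k else 0) x = k"
proof -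
  have "multilin P (\<lambda>S. if S = {} then k else 0) x = (\<Sum>S\<in>{{}}. (if S = {} then k else 0) * prod x S)"
    unfolding multilin_def using assms by (intro sum.mono_neutral_right) auto
  then show ?thesis by simp
qed

section \<open>Elementary symmetric polynomials in the part sizes\<close>

definition esym :: "nat \<Rightarrow> 'a set \<Rightarrow> ('a \<Rightarrow> int) \<Rightarrow> int" where
  "esym m P x = multilin P (\<lambda>S. if card S = m then 1 else 0) x"

lemma esym_two: "finite P \<Longrightarrow> 2 * esym 2 P x = (sum x P)\<^sup>2 - (\<Sum>i\<in>P. (x i)\<^sup>2)"
proof (induction P rule: finite_induct)
  case empty
  then show ?case by (simp add: esym_def multilin_def)
next
  case (insert i P)
  \<comment> \<open>The coefficient of \<open>x i\<close> in degree two: only singletons complete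
    \<open>i\<close> to a pair.\<close>
  have "multilin P (\<lambda>S. if card (insert i S) = 2 then 1 else 0) x = sum x P"
  proof -
    have "multilin P (\<lambda>S. if card (insert i S) = 2 then 1 else 0) x
        = (\<Sum>S\<in>(\<lambda>u. {u}) ` P. (if card (insert i S) = 2 then 1 else 0) * prod x S)"
      unfolding multilin_def
    proof (rule sum.mono_neutral_right)
      show "\<forall>S\<in>Pow P - (\<lambda>u. {u}) ` P. (if card (insert i S) = 2 then 1 else 0) * prod x S = 0"
      proof
        fix S assume S: "S \<in> Pow P - (\<lambda>u. {u}) ` P"
        then have "finite S" "i \<notin> S" using insert finite_subset by auto
        moreover have "card S \<noteq> 1" using S by (auto simp: card_1_singleton_iff)
        ultimately show "(if card (insert i S) = 2 then 1 else 0) * prod x S = 0" by simp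
      qed
    qed (use insert in auto)
    also have "\<dots> = (\<Sum>u\<in>P. (if card {i, u} = 2 then 1 else 0) * x u)"
      by (subst sum.reindex) (auto simp: inj_on_def)
    also have "\<dots> = sum x P"
      using insert by (intro sum.cong) (auto simp: card_insert_if)
    finally show ?thesis .
  qed
  then have "esym 2 (insert i P) x = esym 2 P x + x i * sum x P"
    using insert by (simp add: esym_def multilin_insert)
  then show ?case using insert by (simp add: power2_eq_square algebra_simps)
qed

text \<open>By \<open>esym_two\<close>, near-equal weights have to minimise the sum of squares. For
  an integer \<open>z\<close>, the product \<open>(z - q) * (z - q - 1)\<close> is never negative
  and vanishes exactly at \<open>q\<close> and \<open>q + 1\<close>, the only values of
  \<open>x\<close> when \<open>q\<close> is its minimum.\<close>

lemma esym_balanced_max: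
  assumes "finite P" "\<And>i j. i \<in> P \<Longrightarrow> j \<in> P \<Longrightarrow> x i \<le> x j + 1" "sum y P = sum x P"
  shows "esym 2 P y \<le> esym 2 P x"
proof (cases "P = {}")
  case True
  then show ?thesis by (simp add: esym_def multilin_def)
next
  case False
  define q where "q = Min (x ` P)"
  have "q \<in> x ` P" unfolding q_def using False assms(1) by (intro Min_in) auto
  then obtain j where j: "j \<in> P" "q = x j" by auto
  have q: "x i = q \<or> x i = q + 1" if "i \<in> P" for i
  proof -
    have "q \<le> x i" unfolding q_def using that assms(1) by auto
    then show ?thesis using assms(2)[OF that j(1)] j(2) by linarith
  qed
  \<comment> \<open>Apart from these products, the right side depends on \<open>z\<close> only
    through \<open>sum z P\<close>, which \<open>x\<close> and \<open>y\<close> share.\<close>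
  have exp: "(\<Sum>i\<in>P. (z i)\<^sup>2) = (\<Sum>i\<in>P. (z i - q) * (z i - q - 1)) + (2 * q + 1) * sum z P - of_nat (card P) * (q * (q + 1))" for z
  proof -
    have "(\<Sum>i\<in>P. (z i)\<^sup>2) = (\<Sum>i\<in>P. (z i - q) * (z i - q - 1) + (2 * q + 1) * z i - q * (q + 1))"
      by (intro sum.cong) (auto simp: power2_eq_square algebra_simps)
    then show ?thesis by (simp add: sum.distrib sum_subtractf sum_distrib_left)
  qed
  have "(\<Sum>i\<in>P. (x i - q) * (x i - q - 1)) = 0"
    by (rule sum.neutral) (use q in force)
  moreover have "0 \<le> (\<Sum>i\<in>P. (y i - q) * (y i - q - 1))"
  proof (rule sum_nonneg)
    fix i
    show "0 \<le> (y i - q) * (y i - q - 1)"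
      by (cases "y i \<le> q") (auto intro: mult_nonpos_nonpos mult_nonneg_nonneg)
  qed
  ultimately show ?thesis
    using exp[of x] exp[of y] esym_two[OF assms(1), of x] esym_two[OF assms(1), of y] assms(3) by simp
qed

subsection \<open>Weights of two-coloured complete graphs\<close>

definition blue_on :: "('a set \<Rightarrow> colour) \<Rightarrow> 'a set \<Rightarrow> bool" where
  "blue_on c S \<longleftrightarrow> (\<forall>u\<in>S. \<forall>v\<in>S. u \<noteq> v \<longrightarrow> c {u, v} = Blue)"

text \<open>After cancelling \<open>(t - 1) * (n choose 2)\<close>, the theorem bounds the number of
  blue \<open>r\<close>-cliques plus red edges minus \<open>t - 1\<close> times blue edges; these
  are the contributions of one vertex set. For \<open>r = 2\<close> both summands apply to a blue
  pair.\<close>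

definition weight :: "nat \<Rightarrow> int \<Rightarrow> ('a set \<Rightarrow> colour) \<Rightarrow> 'a set \<Rightarrow> int" where
  "weight r t c S = (if card S = r \<and> blue_on c S then 1 else 0)
     + (if card S = 2 then (if c S = Blue then 1 - t else 1) else 0)"

lemma weight_cong:
  assumes "\<And>u v. u \<in> S \<Longrightarrow> v \<in> S \<Longrightarrow> u \<noteq> v \<Longrightarrow> c {u, v} = c' {u, v}"
  shows "weight r t c S = weight r t c' S"
proof -
  have "blue_on c S = blue_on c' S" using assms by (auto simp: blue_on_def)
  moreover have "c S = c' S" if "card S = 2"
    using that assms by (auto simp: card_2_iff)
  ultimately show ?thesis by (auto simp: weight_def)
qed

text \<open>No blue clique contains a red pair, so only the pair itself, at \<open>S = {}\<close>,
  contributes.\<close>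

lemma multilin_pair_red:
  assumes "finite Q" "i \<notin> Q" "j \<notin> Q" "i \<noteq> j" "r \<ge> 2" "c {i, j} = Red"
  shows "multilin Q (\<lambda>S. weight r t c (insert i (insert j S))) x = 1"
proof -
  have "weight r t c (insert i (insert j S)) = (if S = {} then 1 else 0)" if "S \<subseteq> Q" for S
  proof -
    have "finite S" "i \<notin> S" "j \<notin> S" using that assms finite_subset by auto
    moreover have "\<not> blue_on c (insert i (insert j S))" using assms by (auto simp: blue_on_def)
    ultimately show ?thesis using assms by (auto simp: weight_def)
  qed
  then have "multilin Q (\<lambda>S. weight r t c (insert i (insert j S))) x = multilin Q (\<lambda>S. if S = {} then 1 else 0) x"
    using assms by (intro multilin_cong) auto
  then show ?thesis using assms(1) by (simp add: multilin_delta)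
qed

text \<open>The form on the right counts the weighted extensions of the pair to a blue
  \<open>r\<close>-clique; the pair itself adds \<open>1 - t\<close>. Since
  \<open>r \<ge> 2\<close>, the subtraction \<open>r - 2\<close> is not truncated.\<close>

lemma multilin_pair_blue:
  assumes "finite Q" "i \<notin> Q" "j \<notin> Q" "i \<noteq> j" "r \<ge> 2" "c {i, j} = Blue"
  shows "multilin Q (\<lambda>S. weight r t c (insert i (insert j S))) x
       = multilin Q (\<lambda>S. if card S = r - 2 \<and> blue_on c (insert i (insert j S)) then 1 else 0) x + (1 - t)"
proof -
  have "weight r t c (insert i (insert j S))
      = (if card S = r - 2 \<and> blue_on c (insert i (insert j S)) then 1 else 0) + (if S = {} then 1 - t else 0)"
    if "S \<subseteq> Q" for S
  proof -
    have "finite S" "i \<notin> S" "j \<notin> S" using that assms finite_subset by auto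
    moreover have "Suc (Suc (card S)) = r \<longleftrightarrow> card S = r - 2" using assms by auto
    ultimately show ?thesis using assms by (auto simp: weight_def)
  qed
  then have "multilin Q (\<lambda>S. weight r t c (insert i (insert j S))) x
     = multilin Q (\<lambda>S. (if card S = r - 2 \<and> blue_on c (insert i (insert j S)) then 1 else 0)
          + (if S = {} then 1 - t else 0)) x"
    using assms by (intro multilin_cong) auto
  then show ?thesis using assms(1) by (simp add: multilin_delta multilin_add)
qed

lemma multilin_weight_Red:
  assumes "finite P" "r \<ge> 2"
  shows "multilin P (weight r t (\<lambda>_. Red)) x = esym 2 P x"
proof -
  have "\<not> blue_on (\<lambda>_. Red) S" if "card S = r" for S :: "'a set"
  proof -
    have "card S \<noteq> 0" "card S \<noteq> 1" using that assms(2) by auto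
    then obtain u where u: "u \<in> S" by fastforce
    then obtain v where "v \<in> S" "v \<noteq> u" using \<open>card S \<noteq> 1\<close> by (auto simp: card_1_singleton_iff)
    then show ?thesis using u by (auto simp: blue_on_def)
  qed
  then have "weight r t (\<lambda>_. Red) S = (if card S = 2 then 1 else 0)" for S :: "'a set"
    by (auto simp: weight_def)
  then show ?thesis by (simp add: esym_def multilin_def)
qed

lemma multilin_weight_Blue:
  "multilin P (weight r t (\<lambda>_. Blue)) x = esym r P x - (t - 1) * esym 2 P x"
proof -
  have "weight r t (\<lambda>_. Blue) S = (if card S = r then 1 else 0) + (1 - t) * (if card S = 2 then 1 else 0)"
    for S :: "'a set" by (auto simp: weight_def blue_on_def)
  then have "multilin P (weight r t (\<lambda>_. Blue)) x
     = multilin P (\<lambda>S. (if card S = r then 1 else 0) + (1 - t) * (if card S = 2 then 1 else 0)) x"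
    by (simp add: multilin_def)
  also have "\<dots> = esym r P x + (1 - t) * esym 2 P x"
    unfolding multilin_add multilin_cmult esym_def ..
  finally show ?thesis by (simp add: algebra_simps)
qed

text \<open>For \<open>r = 2\<close> and \<open>t = 1\<close> a pair has weight 1 in either colour,
  so the general optimisation also covers the plain edge count.\<close>

lemma multilin_weight_two_one:
  assumes "finite P"
  shows "multilin P (weight 2 1 c) x = esym 2 P x"
  unfolding esym_def
proof (rule multilin_cong)
  fix S
  have "blue_on c S \<longleftrightarrow> c S = Blue" if "card S = 2"
    using that by (auto simp: blue_on_def card_2_iff insert_commute)
  then show "weight 2 1 c S = (if card S = 2 then 1 else 0)"
    by (auto simp: weight_def)
qed (use assms in auto)

section \<open>Part sizes of a blow-up and existence of an optimum\<close>

definition weighting :: "'a set \<Rightarrow> int \<Rightarrow> ('a \<Rightarrow> int) \<Rightarrow> bool" where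
  "weighting P n x \<longleftrightarrow> (\<forall>i\<in>P. 0 \<le> x i) \<and> sum x P = n"

lemma weighting_fun_upd2:
  assumes "weighting P n x" "finite P" "i \<in> P" "j \<in> P" "i \<noteq> j" "0 \<le> a" "0 \<le> b" "a + b = x i + x j"
  shows "weighting P n (x(i := a, j := b))"
proof -
  have P: "P = insert i (insert j (P - {i, j}))" using assms by auto
  have s: "sum z P = z i + z j + sum z (P - {i, j})" for z :: "'a \<Rightarrow> int"
    using assms by (subst P) simp
  have "sum (x(i := a, j := b)) (P - {i, j}) = sum x (P - {i, j})" by (intro sum.cong) auto
  then have "sum (x(i := a, j := b)) P = sum x P"
    using s[of x] s[of "x(i := a, j := b)"] assms by simp
  then show ?thesis using assms by (auto simp: weighting_def)
qed

lemma weighting_le: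
  assumes "weighting P n x" "finite P" "i \<in> P"
  shows "x i \<le> n"
  using member_le_sum[of i P x] assms by (auto simp: weighting_def)

text \<open>A crude bound that only serves to make a maximum exist: \<open>t \<ge> 1\<close> keeps
  every coefficient at most 2, and every weight is at most \<open>n\<close>.\<close>

lemma multilin_weight_le:
  assumes "weighting P n x" "finite P" "t \<ge> 1"
  shows "multilin P (weight r t c) x \<le> (\<Sum>S\<in>Pow P. 2 * (\<Prod>i\<in>S. n))"
  unfolding multilin_def
proof (rule sum_mono)
  fix S assume "S \<in> Pow P"
  then have S: "S \<subseteq> P" by simp
  have le: "x i \<le> n" "0 \<le> x i" if "i \<in> S" for i
    using that S weighting_le[OF assms(1,2)] assms by (auto simp: weighting_def)
  have "weight r t c S * prod x S \<le> 2 * prod x S"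
    using assms(3) le by (intro mult_right_mono prod_nonneg) (auto simp: weight_def)
  also have "\<dots> \<le> 2 * (\<Prod>i\<in>S. n)" using le by (intro mult_left_mono prod_mono) auto
  finally show "weight r t c S * prod x S \<le> 2 * (\<Prod>i\<in>S. n)" .
qed

lemma esym_singleton_support:
  assumes "finite P" "\<And>j. j \<in> P \<Longrightarrow> j \<noteq> i \<Longrightarrow> x j = 0" "m \<ge> 2"
  shows "esym m P x = 0"
  unfolding esym_def multilin_def
proof (rule sum.neutral, rule ballI)
  fix S assume S: "S \<in> Pow P"
  then have "finite S" using assms finite_subset by auto
  show "(if card S = m then 1 else 0) * prod x S = 0"
  proof (cases "card S = m")
    case True
    then have "\<not> S \<subseteq> {i}" using assms(3) card_mono[of "{i}" S] by auto
    then show ?thesis using S assms \<open>finite S\<close> by auto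
  qed simp
qed

lemma esym_nonneg:
  assumes "\<And>i. i \<in> P \<Longrightarrow> 0 \<le> x i"
  shows "0 \<le> esym m P x"
  unfolding esym_def multilin_def using assms by (intro sum_nonneg mult_nonneg_nonneg prod_nonneg) auto

text \<open>Two nested maximisations: first the form, then the number of red sets among its
  maximisers. The functions are unrestricted outside \<open>P\<close>, so the maxima come from
  bounded natural-valued measures rather than from finiteness.\<close>

lemma blue_red_optimum_exists:
  fixes P :: "'a set" and n :: int
  assumes P: "finite P" "P \<noteq> {}" and "0 \<le> n" "r \<ge> 2" "t \<ge> 1"
  obtains c x where "weighting P n x"
    and "\<And>c' y. weighting P n y \<Longrightarrow> multilin P (weight r t c') y \<le> multilin P (weight r t c) x"
    and "\<And>c' y. weighting P n y \<Longrightarrow> multilin P (weight r t c') y = multilin P (weight r t c) x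
           \<Longrightarrow> card {e \<in> Pow P. c' e = Red} \<le> card {e \<in> Pow P. c e = Red}"
proof -
  define F where "F = (\<lambda>p. multilin P (weight r t (fst p)) (snd p))"
  define ok where "ok = (\<lambda>p::('a set \<Rightarrow> colour) \<times> ('a \<Rightarrow> int). weighting P n (snd p))"
  obtain i where i: "i \<in> P" using P by auto
  \<comment> \<open>A starting point of value 0. The search is restricted to nonnegative values,
    where \<open>nat\<close> is faithful; negative ones are covered afterwards in
    \<open>max\<close>.\<close>
  define p0 :: "('a set \<Rightarrow> colour) \<times> ('a \<Rightarrow> int)" where "p0 = ((\<lambda>_. Red), (\<lambda>j. if j = i then n else 0))"
  have ok0: "ok p0" using i P assms(3) by (simp add: ok_def p0_def weighting_def)
  have F0: "F p0 = 0"
    using P assms(4) by (simp add: F_def p0_def multilin_weight_Red esym_singleton_support[of _ i])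
  have "\<exists>p. (ok p \<and> 0 \<le> F p) \<and> (\<forall>q. ok q \<and> 0 \<le> F q \<longrightarrow> nat (F q) \<le> nat (F p))"
    by (rule ex_has_greatest_nat[where k = p0 and b = "Suc (nat (\<Sum>S\<in>Pow P. 2 * (\<Prod>i\<in>S. n)))"])
      (use ok0 F0 multilin_weight_le[OF _ P(1) assms(5)] in \<open>auto simp: F_def ok_def less_Suc_eq_le intro!: nat_mono\<close>)
  then obtain p where p: "ok p" "0 \<le> F p" "\<And>q. ok q \<Longrightarrow> 0 \<le> F q \<Longrightarrow> nat (F q) \<le> nat (F p)" by blast
  have max: "F q \<le> F p" if "ok q" for q
    using p(2) p(3)[OF that] by (cases "0 \<le> F q") auto
  define red where "red = (\<lambda>q::('a set \<Rightarrow> colour) \<times> ('a \<Rightarrow> int). card {e \<in> Pow P. fst q e = Red})"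
  have "\<exists>s. (ok s \<and> F s = F p) \<and> (\<forall>q. ok q \<and> F q = F p \<longrightarrow> red q \<le> red s)"
    by (rule ex_has_greatest_nat[where k = p and b = "Suc (card (Pow P))"])
      (use p(1) P(1) in \<open>auto simp: red_def less_Suc_eq_le intro!: card_mono\<close>)
  then obtain s where s: "ok s" "F s = F p" "\<And>q. ok q \<Longrightarrow> F q = F p \<Longrightarrow> red q \<le> red s" by blast
  show thesis
  proof (rule that[of "snd s" "fst s"])
    show "weighting P n (snd s)" using s(1) by (simp add: ok_def)
    fix c' y assume y: "weighting P n y"
    show "multilin P (weight r t c') y \<le> multilin P (weight r t (fst s)) (snd s)"
      using max[of "(c', y)"] y s(2) by (simp add: ok_def F_def)
    assume "multilin P (weight r t c') y = multilin P (weight r t (fst s)) (snd s)"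
    then show "card {e \<in> Pow P. c' e = Red} \<le> card {e \<in> Pow P. fst s e = Red}"
      using s(3)[of "(c', y)"] y s(2) by (simp add: ok_def F_def red_def)
  qed
qed

section \<open>Recolouring one pair and cloning a vertex\<close>

lemma multilin_recolour_pair:
  assumes "finite P" "i \<in> P" "j \<in> P" "i \<noteq> j"
  shows "multilin P (weight r t (c({i, j} := d))) x = multilin P (weight r t c) x
     + x i * x j * (multilin (P - {i, j}) (\<lambda>S. weight r t (c({i, j} := d)) (insert i (insert j S))) x
                    - multilin (P - {i, j}) (\<lambda>S. weight r t c (insert i (insert j S))) x)"
proof -
  let ?Q = "P - {i, j}" and ?c = "c({i, j} := d)"
  \<comment> \<open>Only sets containing both \<open>i\<close> and \<open>j\<close> see the
    recolouring, so three of the four coefficients in \<open>multilin_pair\<close> are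
    unchanged.\<close>
  have eq: "multilin ?Q (\<lambda>S. weight r t ?c (h S)) x = multilin ?Q (\<lambda>S. weight r t c (h S)) x"
    if "\<And>S. S \<subseteq> ?Q \<Longrightarrow> \<not> {i, j} \<subseteq> h S" for h
  proof (rule multilin_cong)
    fix S assume "S \<subseteq> ?Q"
    then have "\<not> {i, j} \<subseteq> h S" by (rule that)
    then show "weight r t ?c (h S) = weight r t c (h S)"
      by (intro weight_cong) (auto simp: doubleton_eq_iff)
  qed (use assms in auto)
  have "multilin ?Q (\<lambda>S. weight r t ?c S) x = multilin ?Q (\<lambda>S. weight r t c S) x"
       "multilin ?Q (\<lambda>S. weight r t ?c (insert i S)) x = multilin ?Q (\<lambda>S. weight r t c (insert i S)) x"
       "multilin ?Q (\<lambda>S. weight r t ?c (insert j S)) x = multilin ?Q (\<lambda>S. weight r t c (insert j S)) x"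
    using assms(4) by (rule_tac eq; auto)+
  then show ?thesis
    using multilin_pair[OF assms, of x x "weight r t c"] multilin_pair[OF assms, of x x "weight r t ?c"]
    by (simp add: algebra_simps)
qed

text \<open>The pair \<open>{i, j}\<close> itself keeps its colour.\<close>

definition clone :: "'a \<Rightarrow> 'a \<Rightarrow> ('a set \<Rightarrow> colour) \<Rightarrow> 'a set \<Rightarrow> colour" where
  "clone i j c e = (if j \<in> e \<and> i \<notin> e then c (insert i (e - {j})) else c e)"

text \<open>Replacing \<open>j\<close> by \<open>i\<close> maps \<open>insert j S\<close>
  bijectively onto \<open>insert i S\<close> and carries the cloned colours to the original
  ones.\<close>

lemma weight_clone:
  assumes "i \<notin> S" "j \<notin> S" "i \<noteq> j" "finite S"
  shows "weight r t (clone i j c) (insert j S) = weight r t c (insert i S)"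
proof -
  define f where "f = (\<lambda>u. if u = j then i else u)"
  have colour: "clone i j c {u, v} = c {f u, f v}" if "u \<in> insert j S" "v \<in> insert j S" "u \<noteq> v" for u v
    using that assms by (auto simp: clone_def f_def intro!: arg_cong[of _ _ c])
  have im: "insert i S = f ` insert j S" using assms by (auto simp: f_def)
  have inj: "f u = f v \<longleftrightarrow> u = v" if "u \<in> insert j S" "v \<in> insert j S" for u v
    using that assms by (auto simp: f_def)
  have "blue_on (clone i j c) (insert j S) \<longleftrightarrow> blue_on c (insert i S)"
    unfolding blue_on_def im ball_simps(9) using colour inj by (intro ball_cong refl) auto
  moreover have "clone i j c (insert j S) = c (insert i S)"
    using assms by (auto simp: clone_def)
  ultimately show ?thesis using assms by (simp add: weight_def)
qed

lemma weight_clone_outside: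
  assumes "j \<notin> S" shows "weight r t (clone i j c) S = weight r t c S"
  using assms by (intro weight_cong) (auto simp: clone_def)

text \<open>The pair stays red, so its mixed coefficient is 1 before and after. Only the linear
  coefficient of \<open>x j\<close> changes, into that of \<open>x i\<close>.\<close>

lemma multilin_clone:
  assumes "finite P" "i \<in> P" "j \<in> P" "i \<noteq> j" "r \<ge> 2" "c {i, j} = Red"
  shows "multilin P (weight r t (clone i j c)) x = multilin P (weight r t c) x
     + x j * (multilin (P - {i, j}) (\<lambda>S. weight r t c (insert i S)) x
            - multilin (P - {i, j}) (\<lambda>S. weight r t c (insert j S)) x)"
proof -
  let ?Q = "P - {i, j}" and ?c = "clone i j c"
  have notin: "i \<notin> S" "j \<notin> S" "finite S" if "S \<subseteq> ?Q" for S using that assms(1) finite_subset by auto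
  have "multilin ?Q (weight r t ?c) x = multilin ?Q (weight r t c) x"
    using assms(1) notin by (intro multilin_cong) (simp_all add: weight_clone_outside)
  moreover have "multilin ?Q (\<lambda>S. weight r t ?c (insert i S)) x = multilin ?Q (\<lambda>S. weight r t c (insert i S)) x"
    using assms(1,4) notin by (intro multilin_cong) (simp_all add: weight_clone_outside)
  moreover have "multilin ?Q (\<lambda>S. weight r t ?c (insert j S)) x = multilin ?Q (\<lambda>S. weight r t c (insert i S)) x"
    using assms(1,4) notin by (intro multilin_cong) (simp_all add: weight_clone)
  moreover have "multilin ?Q (\<lambda>S. weight r t c (insert i (insert j S))) x = 1"
                "multilin ?Q (\<lambda>S. weight r t ?c (insert i (insert j S))) x = 1"
    using assms by (auto intro!: multilin_pair_red simp: clone_def)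
  ultimately show ?thesis
    using multilin_pair[OF assms(1-4), of x x "weight r t c"] multilin_pair[OF assms(1-4), of x x "weight r t ?c"]
    by (simp add: algebra_simps)
qed

subsection \<open>Optimal blow-ups\<close>

lemma optimum_no_blue_red_path:
  fixes x :: "'a \<Rightarrow> int"
  assumes P: "finite P" and r: "r \<ge> 2" and x: "weighting P n x"
    and max: "\<And>c' y. weighting P n y \<Longrightarrow> multilin P (weight r t c') y \<le> multilin P (weight r t c) x"
    and max_red: "\<And>c' y. weighting P n y \<Longrightarrow> multilin P (weight r t c') y = multilin P (weight r t c) x
           \<Longrightarrow> card {e \<in> Pow P. c' e = Red} \<le> card {e \<in> Pow P. c e = Red}"
    and ijl: "i \<in> P" "j \<in> P" "l \<in> P" "i \<noteq> j" "i \<noteq> l" "x i \<noteq> 0" "x j \<noteq> 0" "x l \<noteq> 0"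
    and col: "c {i, l} = Blue" "c {i, j} = Red"
  shows False
proof -
  have x0: "0 \<le> x u" if "u \<in> P" for u using x that by (simp add: weighting_def)
  have pos: "0 < x i" "0 < x j" "0 < x l" using x0 ijl by (auto simp: less_le)
  have jl: "j \<noteq> l" using col by auto
  let ?B = "\<lambda>c i j. multilin (P - {i, j}) (\<lambda>S. if card S = r - 2 \<and> blue_on c (insert i (insert j S)) then 1 else 0) x"
  let ?c1 = "c({i, l} := Red)"
  have "multilin (P - {i, l}) (\<lambda>S. weight r t c (insert i (insert l S))) x = ?B c i l + (1 - t)"
    using P ijl r col by (intro multilin_pair_blue) auto
  moreover have "multilin (P - {i, l}) (\<lambda>S. weight r t ?c1 (insert i (insert l S))) x = 1"
    using P ijl r by (intro multilin_pair_red) auto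
  ultimately have c1: "multilin P (weight r t ?c1) x = multilin P (weight r t c) x + x i * x l * (t - ?B c i l)"
    using multilin_recolour_pair[OF P ijl(1,3,5), of r t c Red x] by simp
  \<comment> \<open>Recolouring \<open>{i, l}\<close> red changes the value by
    \<open>x i * x l * (t - ?B c i l)\<close>. A gain contradicts optimality and a tie would give
    one more red set, so the inequality is strict.\<close>
  have gt: "t < ?B c i l"
  proof (rule ccontr)
    assume "\<not> t < ?B c i l"
    then have "0 \<le> x i * x l * (t - ?B c i l)" using pos by simp
    then have "multilin P (weight r t ?c1) x = multilin P (weight r t c) x" using c1 max[OF x, of ?c1] by linarith
    then have le: "card {e \<in> Pow P. ?c1 e = Red} \<le> card {e \<in> Pow P. c e = Red}" by (rule max_red[OF x])
    have "{e \<in> Pow P. c e = Red} \<subset> {e \<in> Pow P. ?c1 e = Red}"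
    proof
      show "{e \<in> Pow P. c e = Red} \<noteq> {e \<in> Pow P. ?c1 e = Red}"
      proof
        assume eq: "{e \<in> Pow P. c e = Red} = {e \<in> Pow P. ?c1 e = Red}"
        have "{i, l} \<in> {e \<in> Pow P. ?c1 e = Red}" using ijl by simp
        then show False unfolding eq[symmetric] using col by simp
      qed
    qed auto
    then have "card {e \<in> Pow P. c e = Red} < card {e \<in> Pow P. ?c1 e = Red}"
      using P by (intro psubset_card_mono) auto
    then show False using le by simp
  qed
  \<comment> \<open>\<open>?d u\<close> is the linear coefficient of \<open>u\<close> off the pair.
    Cloning \<open>j\<close> onto \<open>i\<close> gains nothing, hence
    \<open>?d j \<le> ?d i\<close>, and so cloning \<open>i\<close> onto \<open>j\<close> loses
    nothing.\<close>
  let ?d = "\<lambda>u. multilin (P - {i, j}) (\<lambda>S. weight r t c (insert u S)) x"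
  have "c {j, i} = Red" using col by (simp add: insert_commute)
  then have "multilin P (weight r t (clone j i c)) x = multilin P (weight r t c) x + x i * (?d j - ?d i)"
    using multilin_clone[of P j i r c t x] P ijl r by (simp add: insert_commute)
  then have "x i * (?d j - ?d i) \<le> 0" using max[OF x, of "clone j i c"] by simp
  then have "?d j \<le> ?d i" using pos by (simp add: mult_le_0_iff)
  then have c2: "multilin P (weight r t c) x \<le> multilin P (weight r t (clone i j c)) x"
    using multilin_clone[of P i j r c t x] P ijl r col pos by simp
  let ?c3 = "(clone i j c)({i, j} := Blue)"
  have "multilin (P - {i, j}) (\<lambda>S. weight r t (clone i j c) (insert i (insert j S))) x = 1"
    using P ijl r col by (intro multilin_pair_red) (auto simp: clone_def)
  moreover have "multilin (P - {i, j}) (\<lambda>S. weight r t ?c3 (insert i (insert j S))) x = ?B ?c3 i j + (1 - t)"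
    using P ijl r by (intro multilin_pair_blue) auto
  ultimately have c3: "multilin P (weight r t ?c3) x
      = multilin P (weight r t (clone i j c)) x + x i * x j * (?B ?c3 i j - t)"
    using multilin_recolour_pair[OF P ijl(1,2,4), of r t "clone i j c" Blue x] by simp
  \<comment> \<open>A set forming a blue clique with \<open>i\<close> and \<open>l\<close> avoids
    \<open>j\<close>, because \<open>{i, j}\<close> is red. Under \<open>?c3\<close> it forms a blue
    clique with \<open>i\<close> and its blue twin \<open>j\<close>.\<close>
  have "?B c i l \<le> ?B ?c3 i j"
  proof (rule multilin_le)
    fix S assume S: "S \<subseteq> P - {i, l}"
    {
      assume "\<not> S \<subseteq> P - {i, j}"
      then have "j \<in> S" using S by auto
      then have "\<not> blue_on c (insert i (insert l S))" using col ijl by (auto simp: blue_on_def)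
      then show "(if card S = r - 2 \<and> blue_on c (insert i (insert l S)) then 1 else 0) * prod x S = 0" by simp
    next
      assume S': "S \<subseteq> P - {i, j}"
      have "blue_on ?c3 (insert i (insert j S))" if "blue_on c (insert i (insert l S))"
        unfolding blue_on_def
      proof (intro ballI impI)
        fix u v assume uv: "u \<in> insert i (insert j S)" "v \<in> insert i (insert j S)" "u \<noteq> v"
        have b: "c {u, v} = Blue" if "u \<in> insert i S" "v \<in> insert i S" "u \<noteq> v" for u v
          using that \<open>blue_on c (insert i (insert l S))\<close> by (auto simp: blue_on_def)
        have "j \<notin> S" "i \<notin> S" using S' by auto
        consider "{u, v} = {i, j}" | "j \<notin> {u, v}" | w where "{u, v} = {j, w}" "w \<in> S" "w \<noteq> j" "w \<noteq> i"
          using uv \<open>j \<notin> S\<close> \<open>i \<notin> S\<close> by (cases "u = j"; cases "v = j"; cases "u = i"; cases "v = i"; auto)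
        then show "?c3 {u, v} = Blue"
        proof cases
          case 2
          then show ?thesis using uv b[of u v] by (auto simp: clone_def)
        next
          case 3
          then have "clone i j c {u, v} = c {i, w}"
            using ijl(4) by (auto simp: clone_def intro!: arg_cong[of _ _ c])
          then show ?thesis using 3 b[of i w] by simp
        qed simp
      qed
      then show "(if card S = r - 2 \<and> blue_on c (insert i (insert l S)) then 1 else 0)
          \<le> (if card S = r - 2 \<and> blue_on ?c3 (insert i (insert j S)) then 1 else (0::int))" by simp
    }
  qed (use P x0 in auto)
  then have "0 < x i * x j * (?B ?c3 i j - t)" using gt pos by simp
  then show False using c2 c3 max[OF x, of ?c3] by linarith
qed

text \<open>On the support, pairs sharing a vertex have the same colour, so any pair
  \<open>{u, v}\<close> is linked to a fixed \<open>{i, j}\<close> through \<open>{u, i}\<close>.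
  Colours off the support do not affect the value, hence a constant colouring attains it.\<close>

lemma blue_red_optimum_monochromatic:
  fixes P :: "'a set" and n :: int
  assumes P: "finite P" "P \<noteq> {}" and n: "0 \<le> n" and r: "r \<ge> 2" and t: "t \<ge> 1"
  obtains d x where "weighting P n x"
    and "\<And>c y. weighting P n y \<Longrightarrow> multilin P (weight r t c) y \<le> multilin P (weight r t (\<lambda>_. d)) x"
proof -
  obtain c x where x: "weighting P n x"
    and max: "\<And>c' y. weighting P n y \<Longrightarrow> multilin P (weight r t c') y \<le> multilin P (weight r t c) x"
    and max_red: "\<And>c' y. weighting P n y \<Longrightarrow> multilin P (weight r t c') y = multilin P (weight r t c) x
           \<Longrightarrow> card {e \<in> Pow P. c' e = Red} \<le> card {e \<in> Pow P. c e = Red}"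
    by (rule blue_red_optimum_exists[OF P n r t]) (rule that)
  define A where "A = {i \<in> P. x i \<noteq> 0}"
  have no_path: False if "i \<in> A" "j \<in> A" "l \<in> A" "i \<noteq> j" "i \<noteq> l" "c {i, l} = Blue" "c {i, j} = Red" for i j l
    by (rule optimum_no_blue_red_path[OF P(1) r x, of t c i j l])
      (rule max, assumption, rule max_red, assumption, assumption, use that in \<open>auto simp: A_def\<close>)
  have path: "c {i, l} = c {i, j}" if "i \<in> A" "j \<in> A" "l \<in> A" "i \<noteq> j" "i \<noteq> l" for i j l
    using no_path[of i j l] no_path[of i l j] that by (cases "c {i, l}"; cases "c {i, j}") simp_all
  have "\<exists>d. \<forall>u\<in>A. \<forall>v\<in>A. u \<noteq> v \<longrightarrow> c {u, v} = d"
  proof (cases "\<exists>i\<in>A. \<exists>j\<in>A. i \<noteq> j")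
    case True
    then obtain i j where ij: "i \<in> A" "j \<in> A" "i \<noteq> j" by auto
    have "c {u, v} = c {i, j}" if "u \<in> A" "v \<in> A" "u \<noteq> v" for u v
    proof (cases "u = i")
      case True
      then show ?thesis using path[of i j v] that ij by auto
    next
      case False
      then have "c {u, v} = c {u, i}" using path[of u i v] that ij by auto
      also have "\<dots> = c {i, u}" by (simp add: insert_commute)
      also have "\<dots> = c {i, j}" using path[of i j u] that ij False by auto
      finally show ?thesis .
    qed
    then show ?thesis by blast
  qed blast
  then obtain d where d: "\<And>u v. u \<in> A \<Longrightarrow> v \<in> A \<Longrightarrow> u \<noteq> v \<Longrightarrow> c {u, v} = d" by blast
  have "multilin P (weight r t c) x = multilin P (weight r t (\<lambda>_. d)) x"
  proof (rule multilin_cong)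
    fix S assume "S \<subseteq> P" "\<And>i. i \<in> S \<Longrightarrow> x i \<noteq> 0"
    then show "weight r t c S = weight r t (\<lambda>_. d) S"
      by (intro weight_cong d) (auto simp: A_def)
  qed (use P in auto)
  then show thesis using that[OF x, of d] max by simp
qed

text \<open>Under a constant colouring \<open>i\<close> and \<open>j\<close> have equal linear
  coefficients, so moving one unit from \<open>i\<close> to \<open>j\<close> changes only the mixed
  term, by \<open>x i - x j - 1\<close> times \<open>?B i j + (1 - t)\<close>. The latter is at
  least 1 because recolouring a pair red is no improvement.\<close>

lemma blue_optimum_balanced:
  fixes P :: "'a set" and n :: int
  assumes P: "finite P" and r: "r \<ge> 2" and t: "t \<ge> 1" and x: "weighting P n x"
    and max: "\<And>c y. weighting P n y \<Longrightarrow> multilin P (weight r t c) y \<le> multilin P (weight r t (\<lambda>_. Blue)) x"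
    and il: "i \<in> P" "l \<in> P" "i \<noteq> l" "x i \<noteq> 0" "x l \<noteq> 0" and j: "j \<in> P"
  shows "x i \<le> x j + 1"
proof (rule ccontr)
  assume "\<not> x i \<le> x j + 1"
  then have ge: "x i \<ge> x j + 2" by simp
  have x0: "0 \<le> x u" if "u \<in> P" for u using x that by (simp add: weighting_def)
  have pos: "0 < x i" "0 < x l" using x0 il by (auto simp: less_le)
  have ij: "i \<noteq> j" using ge by auto
  let ?c = "\<lambda>_. Blue"
  let ?B = "\<lambda>i j. multilin (P - {i, j}) (\<lambda>S. if card S = r - 2 \<and> blue_on ?c (insert i (insert j S)) then 1 else 0) x"
  have B: "multilin (P - {i, m}) (\<lambda>S. weight r t ?c (insert i (insert m S))) x = ?B i m + (1 - t)"
    if "m \<noteq> i" for m using P that r by (intro multilin_pair_blue) auto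
  have link: "t \<le> ?B i m" if m: "m \<in> P" "m \<noteq> i" "x m \<noteq> 0" for m
  proof -
    have "0 < x m" using x0 m by (auto simp: less_le)
    have "multilin (P - {i, m}) (\<lambda>S. weight r t (?c({i, m} := Red)) (insert i (insert m S))) x = 1"
      using P m r by (intro multilin_pair_red) auto
    then have "multilin P (weight r t (?c({i, m} := Red))) x = multilin P (weight r t ?c) x + x i * x m * (t - ?B i m)"
      using multilin_recolour_pair[OF P il(1) m(1) m(2)[symmetric], of r t ?c Red x] B[of m] m by simp
    then have "x i * x m * (t - ?B i m) \<le> 0" using max[OF x, of "?c({i, m} := Red)"] by simp
    then show ?thesis using pos \<open>0 < x m\<close> by (simp add: mult_le_0_iff)
  qed
  \<comment> \<open>If \<open>x j = 0\<close>, recolouring \<open>{i, j}\<close> leaves the value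
    unchanged and gives no bound. The bound for \<open>{i, l}\<close> carries over: its extensions
    through \<open>j\<close> have weight zero, and all others also extend
    \<open>{i, j}\<close>.\<close>
  have "t \<le> ?B i j"
  proof (cases "x j = 0")
    case True
    have "?B i l \<le> ?B i j"
    proof (rule multilin_le)
      fix S assume S: "S \<subseteq> P - {i, l}" "\<not> S \<subseteq> P - {i, j}"
      then have "j \<in> S" "finite S" using P finite_subset by auto
      then show "(if card S = r - 2 \<and> blue_on ?c (insert i (insert l S)) then 1 else 0) * prod x S = 0"
        using True by auto
    qed (use P x0 in \<open>auto simp: blue_on_def\<close>)
    then show ?thesis using link[of l] il by simp
  qed (use link[of j] j ij in auto)
  let ?y = "x(i := x i - 1, j := x j + 1)"
  have y: "weighting P n ?y"
    using x P il j ij ge x0[OF j] by (intro weighting_fun_upd2) auto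
  have "multilin (P - {i, j}) (\<lambda>S. weight r t ?c (insert i S)) x = multilin (P - {i, j}) (\<lambda>S. weight r t ?c (insert j S)) x"
  proof (rule multilin_cong)
    fix S assume "S \<subseteq> P - {i, j}"
    then have "finite S" "i \<notin> S" "j \<notin> S" using P finite_subset by auto
    then show "weight r t ?c (insert i S) = weight r t ?c (insert j S)"
      by (simp add: weight_def blue_on_def)
  qed (use P in auto)
  then have "multilin P (weight r t ?c) ?y
      = multilin P (weight r t ?c) x + (x i - x j - 1) * (?B i j + (1 - t))"
    using multilin_pair[OF P il(1) j ij, of ?y x "weight r t ?c"] multilin_pair[OF P il(1) j ij, of x x "weight r t ?c"]
      B[of j] ij by (simp add: algebra_simps)
  moreover have "0 < (x i - x j - 1) * (?B i j + (1 - t))"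
    using ge \<open>t \<le> ?B i j\<close> by (intro mult_pos_pos) auto
  ultimately show False using max[OF y, of ?c] by linarith
qed

text \<open>One \<open>x\<close> has to maximise \<open>esym 2\<close> and also bound the form, so
  that a single blow-up realises both terms. If the optimum of the form is at most the maximum of
  \<open>esym 2\<close>, a maximiser of the latter works; otherwise the optimum is blue and
  balanced.\<close>

lemma multilin_weight_bound:
  fixes P :: "'a set" and n :: int
  assumes P: "finite P" "P \<noteq> {}" and n: "0 \<le> n" and r: "r \<ge> 2" and t: "t \<ge> 1"
  obtains x where "weighting P n x" and "\<And>y. weighting P n y \<Longrightarrow> esym 2 P y \<le> esym 2 P x"
    and "\<And>c y. weighting P n y
       \<Longrightarrow> multilin P (weight r t c) y \<le> max (esym r P x - (t - 1) * esym 2 P x) (esym 2 P x)"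
proof -
  obtain c0 x2 where x2: "weighting P n x2"
    and "\<And>c' y. weighting P n y \<Longrightarrow> multilin P (weight 2 1 c') y \<le> multilin P (weight 2 1 c0) x2"
    by (rule blue_red_optimum_exists[OF P n, of 2 1]) (simp, simp, rule that)
  then have max2: "esym 2 P y \<le> esym 2 P x2" if "weighting P n y" for y
    using that P(1) by (simp add: multilin_weight_two_one)
  obtain d x where x: "weighting P n x"
    and max: "\<And>c y. weighting P n y \<Longrightarrow> multilin P (weight r t c) y \<le> multilin P (weight r t (\<lambda>_. d)) x"
    by (rule blue_red_optimum_monochromatic[OF P n r t]) (rule that)
  show thesis
  proof (cases "multilin P (weight r t (\<lambda>_. d)) x \<le> esym 2 P x2")
    case True
    then show ?thesis using that[OF x2 max2] max order_trans max.coboundedI2 by metis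
  next
    case False
    \<comment> \<open>A red optimum would have value \<open>esym 2 P x\<close>, at most
      \<open>esym 2 P x2\<close>.\<close>
    have d: "d = Blue"
      using False max2[OF x] P(1) r by (cases d) (auto simp: multilin_weight_Red)
    have nonneg: "0 \<le> esym 2 P x2" using x2 by (intro esym_nonneg) (auto simp: weighting_def)
    have "x i \<le> x j + 1" if ij: "i \<in> P" "j \<in> P" for i j
    \<comment> \<open>Balancing needs a second vertex of positive weight. Without one the form is 0,
      which is excluded in the present case.\<close>
    proof (cases "x i = 0 \<or> (\<forall>l\<in>P. l \<noteq> i \<longrightarrow> x l = 0)")
      case True
      then show ?thesis
      proof
        assume "\<forall>l\<in>P. l \<noteq> i \<longrightarrow> x l = 0"
        then have "multilin P (weight r t (\<lambda>_. d)) x = 0"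
          using P(1) r d by (simp add: multilin_weight_Blue esym_singleton_support[of _ i])
        then show ?thesis using False nonneg by simp
      qed (use x ij in \<open>auto simp: weighting_def\<close>)
    next
      case False
      then obtain l where "l \<in> P" "l \<noteq> i" "x l \<noteq> 0" "x i \<noteq> 0" by auto
      then show ?thesis
        using blue_optimum_balanced[OF P(1) r t x max[unfolded d], of i l j] ij by auto
    qed
    then have "esym 2 P y \<le> esym 2 P x" if "weighting P n y" for y
      using that x P(1) by (intro esym_balanced_max) (auto simp: weighting_def)
    moreover have "multilin P (weight r t (\<lambda>_. d)) x = esym r P x - (t - 1) * esym 2 P x"
      by (simp add: d multilin_weight_Blue)
    ultimately show ?thesis using that[OF x] max by (metis max.coboundedI1)
  qed
qed

subsection \<open>Graphs and blow-ups\<close>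

text \<open>A copy of a complete graph is determined by its vertex set, so copies are counted as
  vertex sets.\<close>

definition cliques :: "nat \<Rightarrow> 'a graph \<Rightarrow> 'a set set" where
  "cliques m G = {S. S \<subseteq> verts G \<and> card S = m \<and> (\<forall>u\<in>S. \<forall>v\<in>S. u \<noteq> v \<longrightarrow> {u, v} \<in> edges G)}"

lemma image_pairs:
  assumes "inj_on f A"
  shows "(`) f ` {e. e \<subseteq> A \<and> card e = 2} = {e. e \<subseteq> f ` A \<and> card e = 2}" (is "?L = ?R")
proof
  show "?L \<subseteq> ?R"
    using assms by (auto simp: card_image inj_on_subset)
  show "?R \<subseteq> ?L"
  proof
    fix e assume e: "e \<in> ?R"
    then obtain U where "U \<subseteq> A" "inj_on f U" "e = f ` U" by (auto simp: subset_image_inj)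
    then show "e \<in> ?L" using e by (auto simp: card_image)
  qed
qed

text \<open>Every bijection carries all pairs onto all pairs, so the edge condition does not depend
  on the choice of \<open>f\<close>.\<close>

lemma graph_iso_complete:
  "graph_iso (complete_graph m) S
     \<longleftrightarrow> (\<exists>f. bij_betw f {..<m} (verts S)) \<and> edges S = {e. e \<subseteq> verts S \<and> card e = 2}"
proof -
  have "(`) f ` edges (complete_graph m) = {e. e \<subseteq> verts S \<and> card e = 2}"
    if "bij_betw f {..<m} (verts S)" for f
    using that image_pairs[of f "{..<m}"] by (simp add: complete_graph_def bij_betw_def)
  moreover have "verts (complete_graph m) = {..<m}" by (simp add: complete_graph_def)
  ultimately show ?thesis unfolding graph_iso_def by auto
qed

lemma copies_complete:
  assumes "simple_graph G"
  shows "copies (complete_graph m) G = (\<lambda>S. \<lparr>verts = S, edges = {e. e \<subseteq> S \<and> card e = 2}\<rparr>) ` cliques m G"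
    (is "?L = ?g ` _")
proof
  have fin: "finite (verts G)" using assms by (simp add: simple_graph_def)
  show "?L \<subseteq> ?g ` cliques m G"
  proof
    fix S assume S: "S \<in> ?L"
    then obtain f where f: "bij_betw f {..<m} (verts S)"
      and E: "edges S = {e. e \<subseteq> verts S \<and> card e = 2}" and sub: "subgraph S G"
      by (auto simp: copies_def graph_iso_complete)
    have "card (verts S) = m" using bij_betw_same_card[OF f] by simp
    moreover have "{u, v} \<in> edges G" if "u \<in> verts S" "v \<in> verts S" "u \<noteq> v" for u v
    proof -
      have "{u, v} \<in> edges S" using that by (simp add: E)
      then show ?thesis using sub by (auto simp: subgraph_def)
    qed
    ultimately have "verts S \<in> cliques m G" using sub by (auto simp: cliques_def subgraph_def)
    moreover have "S = ?g (verts S)" using E by simp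
    ultimately show "S \<in> ?g ` cliques m G" by blast
  qed
  show "?g ` cliques m G \<subseteq> ?L"
  proof
    fix H assume "H \<in> ?g ` cliques m G"
    then obtain S where S: "S \<in> cliques m G" "H = ?g S" by auto
    then have "finite S" "card S = m" using fin by (auto simp: cliques_def finite_subset)
    then have "\<exists>f. bij_betw f {..<m} S" using finite_same_card_bij[of "{..<m}" S] by simp
    moreover have "e \<in> edges G" if "e \<subseteq> S" "card e = 2" for e
      using that S(1) by (auto simp: cliques_def card_2_iff)
    ultimately show "H \<in> ?L" using S \<open>finite S\<close>
      by (auto simp: copies_def graph_iso_complete subgraph_def simple_graph_def cliques_def)
  qed
qed

lemma num_copies_complete:
  assumes "simple_graph G"
  shows "num_copies (complete_graph m) G = card (cliques m G)"
  unfolding num_copies_def copies_complete[OF assms]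
  by (rule card_image) (auto simp: inj_on_def)

lemma graph_free_complete:
  assumes "simple_graph G"
  shows "graph_free (complete_graph m) G \<longleftrightarrow> cliques m G = {}"
  by (simp add: graph_free_def copies_complete[OF assms])

lemma cliques_two:
  assumes "simple_graph G"
  shows "cliques 2 G = edges G"
  using assms by (auto simp: cliques_def simple_graph_def card_2_iff insert_commute)

section \<open>Extremal numbers as maxima of clique counts\<close>

lemma card_edges_eq_num_copies:
  "simple_graph G \<Longrightarrow> card (edges G) = num_copies (complete_graph 2) G"
  by (simp add: num_copies_complete cliques_two)

lemma ex_num_eq_gen_ex_num: "ex_num n F = gen_ex_num n (complete_graph 2) F"
proof -
  have "{card (edges G) | G :: nat graph. simple_graph G \<and> card (verts G) = n \<and> graph_free F G}
      = {num_copies (complete_graph 2) G | G :: nat graph. simple_graph G \<and> card (verts G) = n \<and> graph_free F G}"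
    by (rule Collect_cong) (metis card_edges_eq_num_copies)
  then show ?thesis by (simp add: ex_num_def gen_ex_num_def)
qed

lemma finite_num_copies_complete:
  "finite {num_copies (complete_graph r) G | G :: nat graph. simple_graph G \<and> card (verts G) = n \<and> graph_free F G}"
proof (rule finite_subset)
  show "{num_copies (complete_graph r) G | G :: nat graph. simple_graph G \<and> card (verts G) = n \<and> graph_free F G}
      \<subseteq> {..2 ^ n}"
  proof
    fix m assume "m \<in> {num_copies (complete_graph r) G | G :: nat graph.
        simple_graph G \<and> card (verts G) = n \<and> graph_free F G}"
    then obtain G :: "nat graph" where G: "simple_graph G" "card (verts G) = n"
      and m: "m = num_copies (complete_graph r) G" by auto
    have "finite (verts G)" using G by (simp add: simple_graph_def)
    moreover have "cliques r G \<subseteq> Pow (verts G)" by (auto simp: cliques_def)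
    ultimately have "card (cliques r G) \<le> 2 ^ n" using G(2) card_mono[of "Pow (verts G)"] by (simp add: card_Pow)
    then show "m \<in> {..2 ^ n}" using G m by (simp add: num_copies_complete)
  qed
qed simp

lemma num_copies_le_gen_ex_num:
  fixes G :: "nat graph"
  assumes "simple_graph G" "graph_free F G"
  shows "num_copies (complete_graph r) G \<le> gen_ex_num (card (verts G)) (complete_graph r) F"
  unfolding gen_ex_num_def using assms by (intro Max_ge finite_num_copies_complete) auto

lemma gen_ex_num_attained:
  fixes G :: "nat graph"
  assumes "simple_graph G" "graph_free F G"
  obtains H :: "nat graph" where "simple_graph H" "card (verts H) = card (verts G)" "graph_free F H"
    "gen_ex_num (card (verts G)) (complete_graph r) F = num_copies (complete_graph r) H"
proof -
  let ?X = "{num_copies (complete_graph r) H | H :: nat graph.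
               simple_graph H \<and> card (verts H) = card (verts G) \<and> graph_free F H}"
  have "Max ?X \<in> ?X" using assms by (intro Max_in finite_num_copies_complete) auto
  then show thesis using that by (auto simp: gen_ex_num_def)
qed

section \<open>Realising a weighting by a graph without large cliques\<close>

lemma blowup_graph:
  assumes x: "weighting P (int n) x" and P: "finite P" "card P < k"
  obtains G :: "nat graph" where "simple_graph G" "card (verts G) = n" "graph_free (complete_graph k) G"
    and "\<And>r. esym r P x \<le> int (num_copies (complete_graph r) G)"
proof -
  let ?D = "Sigma P (\<lambda>i. {..<nat (x i)})"
  have x0: "0 \<le> x i" if "i \<in> P" for i using x that by (simp add: weighting_def)
  have "int (card ?D) = (\<Sum>i\<in>P. int (nat (x i)))" using P by simp
  also have "\<dots> = int n" using x by (auto simp: weighting_def intro!: trans[OF sum.cong])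
  finally have cD: "card ?D = n" by simp
  \<comment> \<open>\<open>?D\<close> is the disjoint union of the parts; enumerating it by
    \<open>h\<close> moves the vertices to \<open>nat\<close>.\<close>
  obtain h where h: "bij_betw h {0..<n} ?D"
    using ex_bij_betw_nat_finite[of ?D] P cD by auto
  define p where "p = fst \<circ> h"
  define fib where "fib i = {v \<in> {0..<n}. p v = i}" for i
  \<comment> \<open>\<open>p\<close> names the part of a vertex, and edges join different parts. So
    a clique is a set on which \<open>p\<close> is injective, with at most \<open>card P < k\<close>
    elements.\<close>
  define G where "G = \<lparr>verts = {0..<n}, edges = {e. e \<subseteq> {0..<n} \<and> card e = 2 \<and> inj_on p e}\<rparr>"
  have pP: "p v \<in> P" if "v < n" for v
    using bij_betwE[OF h] that by (force simp: p_def)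
  have card_fib: "int (card (fib i)) = x i" if i: "i \<in> P" for i
  proof -
    have "h ` fib i = {i} \<times> {..<nat (x i)}"
    proof
      show "h ` fib i \<subseteq> {i} \<times> {..<nat (x i)}"
        using bij_betwE[OF h] by (force simp: fib_def p_def)
      show "{i} \<times> {..<nat (x i)} \<subseteq> h ` fib i"
      proof
        fix q assume q: "q \<in> {i} \<times> {..<nat (x i)}"
        then have "q \<in> h ` {0..<n}" using h i by (auto simp: bij_betw_def)
        then obtain v where v: "v \<in> {0..<n}" "q = h v" by blast
        then have "v \<in> fib i" using q by (auto simp: fib_def p_def)
        then show "q \<in> h ` fib i" using v by blast
      qed
    qed
    moreover have "inj_on h (fib i)"
      using bij_betw_imp_inj_on[OF h] by (rule inj_on_subset) (auto simp: fib_def)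
    ultimately have "card (fib i) = card ({i} \<times> {..<nat (x i)})" by (metis card_image)
    then show ?thesis using x0[OF i] by simp
  qed
  have simple: "simple_graph G" by (auto simp: simple_graph_def G_def)
  have cliques: "cliques m G = {T. T \<subseteq> {0..<n} \<and> card T = m \<and> inj_on p T}" for m
    by (auto simp: cliques_def G_def inj_on_def)
  have "T \<notin> cliques k G" for T
  proof
    assume "T \<in> cliques k G"
    then have "inj_on p T" "p ` T \<subseteq> P" "card T = k" using pP by (auto simp: cliques)
    then have "k \<le> card P" using card_inj_on_le[of p T P] P by simp
    then show False using P by simp
  qed
  then have free: "graph_free (complete_graph k) G" using graph_free_complete[OF simple] by auto
  have "esym r P x \<le> int (num_copies (complete_graph r) G)" for r
  proof -
    let ?S = "{S \<in> Pow P. card S = r}"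
    have finS: "finite S" if "S \<in> ?S" for S using that P finite_subset by auto
    have "esym r P x = (\<Sum>S\<in>?S. prod x S)"
      unfolding esym_def multilin_def using P by (intro sum.mono_neutral_cong_right) auto
    \<comment> \<open>\<open>prod x S\<close> counts the ways to choose one vertex from each part in
      \<open>S\<close>.\<close>
    also have "\<dots> = (\<Sum>S\<in>?S. int (card (PiE S fib)))"
    proof (rule sum.cong)
      fix S assume S: "S \<in> ?S"
      then have "prod x S = (\<Prod>i\<in>S. int (card (fib i)))" using card_fib by (intro prod.cong) auto
      then show "prod x S = int (card (PiE S fib))" using finS[OF S] by (simp add: card_PiE)
    qed simp
    also have "\<dots> = int (card (Sigma ?S (\<lambda>S. PiE S fib)))"
    proof -
      have "finite ?S" using P by simp
      moreover have "\<forall>S\<in>?S. finite (PiE S fib)"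
      proof (intro ballI finite_PiE)
        fix S assume "S \<in> ?S"
        then show "finite S" by (rule finS)
      qed (simp add: fib_def)
      ultimately have "card (Sigma ?S (\<lambda>S. PiE S fib)) = (\<Sum>S\<in>?S. card (PiE S fib))"
        by (rule card_SigmaI)
      then show ?thesis by simp
    qed
    \<comment> \<open>A choice function is sent to its image, an \<open>r\<close>-clique;
      \<open>p\<close> recovers first the index set \<open>S\<close> and then the function, so the
      map is injective.\<close>
    also have "card (Sigma ?S (\<lambda>S. PiE S fib)) \<le> card (cliques r G)"
    proof (rule card_inj_on_le)
      have pf: "p (f i) = i" if "f \<in> PiE S fib" "i \<in> S" for f S i
        using PiE_mem[OF that] by (simp add: fib_def)
      have img: "p ` f ` S = S" if "f \<in> PiE S fib" for f S
        using pf[OF that] by force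
      show "inj_on (\<lambda>(S, f). f ` S) (Sigma ?S (\<lambda>S. PiE S fib))"
      proof (rule inj_onI)
        fix q q' assume q: "q \<in> Sigma ?S (\<lambda>S. PiE S fib)" "q' \<in> Sigma ?S (\<lambda>S. PiE S fib)"
          and eq: "(\<lambda>(S, f). f ` S) q = (\<lambda>(S, f). f ` S) q'"
        obtain S f S' f' where qq: "q = (S, f)" "q' = (S', f')" by (cases q, cases q')
        have f: "f \<in> PiE S fib" "f' \<in> PiE S' fib" and im: "f ` S = f' ` S'" using q eq qq by auto
        have SS: "S = S'" using img[OF f(1)] img[OF f(2)] im by simp
        have "f i = f' i" if "i \<in> S" for i
        proof -
          have "f i \<in> f' ` S'" using that unfolding im[symmetric] by (rule imageI)
          then obtain l where "l \<in> S'" "f i = f' l" by (rule imageE)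
          then show ?thesis using pf[OF f(1) that] pf[OF f(2)] by metis
        qed
        then have "f = f'" using f SS by (intro PiE_ext[of f S fib f']) auto
        then show "q = q'" using qq SS by simp
      qed
      show "(\<lambda>(S, f). f ` S) ` Sigma ?S (\<lambda>S. PiE S fib) \<subseteq> cliques r G"
      proof
        fix T assume "T \<in> (\<lambda>(S, f). f ` S) ` Sigma ?S (\<lambda>S. PiE S fib)"
        then obtain S f where T: "T = f ` S" and S: "S \<in> ?S" and f: "f \<in> PiE S fib" by auto
        have "f i \<in> {0..<n}" if "i \<in> S" for i using PiE_mem[OF f that] by (simp add: fib_def)
        moreover have "inj_on f S" using pf[OF f] by (metis inj_onI)
        moreover have "inj_on p (f ` S)" using pf[OF f] by (intro inj_onI) auto
        ultimately show "T \<in> cliques r G" using S by (auto simp: T cliques card_image)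
      qed
      show "finite (cliques r G)" by (rule finite_subset[of _ "Pow {0..<n}"]) (auto simp: cliques)
    qed
    finally show ?thesis using num_copies_complete[OF simple] by simp
  qed
  then show thesis using that[of G] simple free by (simp add: G_def)
qed

section \<open>Symmetrising a graph to a weighted clique\<close>

lemma clique_supported_weighting:
  assumes V: "finite V" and x: "weighting V n x"
    and a: "\<And>S u v. u \<in> S \<Longrightarrow> v \<in> S \<Longrightarrow> u \<noteq> v \<Longrightarrow> {u, v} \<notin> E \<Longrightarrow> a S = 0"
  shows "\<exists>y. weighting V n y \<and> multilin V a x \<le> multilin V a y
    \<and> (\<forall>u\<in>V. \<forall>v\<in>V. u \<noteq> v \<and> y u \<noteq> 0 \<and> y v \<noteq> 0 \<longrightarrow> {u, v} \<in> E)"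
  using x
\<comment> \<open>Induction on the size of the support: while it contains a non-adjacent pair, one
  of the two vertices is emptied without loss.\<close>
proof (induction "card {u \<in> V. x u \<noteq> 0}" arbitrary: x rule: less_induct)
  case less
  show ?case
  proof (cases "\<exists>u\<in>V. \<exists>v\<in>V. u \<noteq> v \<and> x u \<noteq> 0 \<and> x v \<noteq> 0 \<and> {u, v} \<notin> E")
    case False
    then show ?thesis using less.prems by blast
  next
    case True
    then obtain u0 v0 where uv0: "u0 \<in> V" "v0 \<in> V" "u0 \<noteq> v0" "x u0 \<noteq> 0" "x v0 \<noteq> 0" "{u0, v0} \<notin> E"
      by blast
    let ?lin = "\<lambda>u v w. multilin (V - {u, v}) (\<lambda>S. a (insert w S)) x"
    \<comment> \<open>\<open>u\<close> is chosen as the vertex of the pair with the larger linear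
      coefficient.\<close>
    obtain u v where uv: "u \<in> V" "v \<in> V" "u \<noteq> v" "x u \<noteq> 0" "x v \<noteq> 0" "{u, v} \<notin> E"
      and le: "?lin u v v \<le> ?lin u v u"
    proof (cases "?lin u0 v0 v0 \<le> ?lin u0 v0 u0")
      case True
      then show ?thesis using that uv0 by blast
    next
      case False
      then show ?thesis using that[of v0 u0] uv0 by (simp add: insert_commute)
    qed
    let ?y = "x(u := x u + x v, v := 0)"
    have x0: "0 \<le> x u" "0 \<le> x v" using less.prems uv by (auto simp: weighting_def)
    have y: "weighting V n ?y"
      using less.prems V uv x0 by (intro weighting_fun_upd2) auto
    \<comment> \<open>Without a mixed term the form is linear in the weights of \<open>u\<close> and
      \<open>v\<close>, so moving all of \<open>x v\<close> to \<open>u\<close> cannot decrease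
      it.\<close>
    have "multilin (V - {u, v}) (\<lambda>S. a (insert u (insert v S))) x = 0"
      unfolding multilin_def using uv by (intro sum.neutral) (auto intro!: a[of u _ v])
    then have "multilin V a ?y = multilin V a x + x v * (?lin u v u - ?lin u v v)"
      using multilin_pair[OF V uv(1-3), of ?y x a] multilin_pair[OF V uv(1-3), of x x a] uv(3)
      by (simp add: algebra_simps)
    then have inc: "multilin V a x \<le> multilin V a ?y" using le x0 by simp
    have "{w \<in> V. ?y w \<noteq> 0} \<subset> {w \<in> V. x w \<noteq> 0}" using uv x0 by auto
    then have "card {w \<in> V. ?y w \<noteq> 0} < card {w \<in> V. x w \<noteq> 0}"
      using V by (intro psubset_card_mono) auto
    then obtain z where "weighting V n z" "multilin V a ?y \<le> multilin V a z"
      "\<forall>u\<in>V. \<forall>v\<in>V. u \<noteq> v \<and> z u \<noteq> 0 \<and> z v \<noteq> 0 \<longrightarrow> {u, v} \<in> E"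
      using less.hyps[OF _ y] by blast
    then show ?thesis using inc by (meson order_trans)
  qed
qed

lemma weight_image:
  assumes "inj_on g S"
  shows "weight r t c (g ` S) = weight r t (\<lambda>e. c (g ` e)) S"
proof -
  have "blue_on c (g ` S) = blue_on (\<lambda>e. c (g ` e)) S"
    using assms by (auto simp: blue_on_def inj_on_def)
  then show ?thesis using assms by (simp add: weight_def card_image)
qed

text \<open>Relabels \<open>T\<close> inside \<open>P\<close> and pads with weight zero, so that
  cliques of different sizes can be compared over one fixed vertex set.\<close>

lemma weighting_transfer:
  assumes T: "weighting T n y" and fin: "finite T" "finite P" and le: "card T \<le> card P"
  obtains c' z where "weighting P n z" "multilin T (weight r t c) y = multilin P (weight r t c') z"
proof -
  obtain h where h: "h ` T \<subseteq> P" "inj_on h T" using card_le_inj[OF fin le] by blast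
  define g where "g = inv_into T h"
  have g: "inj_on g (h ` T)" "g ` h ` T = T"
    using h(2) by (auto simp: g_def inj_on_inv_into image_iff)
  define z where "z i = (if i \<in> h ` T then y (g i) else 0)" for i
  have "multilin T (weight r t c) y = multilin (h ` T) (\<lambda>S. weight r t c (g ` S)) (y \<circ> g)"
    using multilin_reindex[OF g(1)] g(2) by metis
  also have "\<dots> = multilin (h ` T) (weight r t (\<lambda>e. c (g ` e))) z"
  proof (rule multilin_cong)
    fix S assume "S \<subseteq> h ` T"
    then show "weight r t c (g ` S) = weight r t (\<lambda>e. c (g ` e)) S"
      using g(1) by (intro weight_image) (rule inj_on_subset)
  qed (use fin in \<open>auto simp: z_def\<close>)
  also have "\<dots> = multilin P (weight r t (\<lambda>e. c (g ` e))) z"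
    using fin h by (intro multilin_superset[symmetric]) (auto simp: z_def)
  finally have eq: "multilin T (weight r t c) y = \<dots>" .
  have "sum z P = sum z (h ` T)"
    using fin h by (intro sum.mono_neutral_right) (auto simp: z_def)
  also have "\<dots> = sum (y \<circ> g) (h ` T)" by (intro sum.cong) (auto simp: z_def)
  also have "\<dots> = sum y T" using sum.reindex[OF g(1), of y] g(2) by simp
  finally have "sum z P = n" using T by (simp add: weighting_def)
  moreover have "0 \<le> z i" for i
  proof (cases "i \<in> h ` T")
    case True
    then have "g i \<in> T" using g(2) by blast
    then show ?thesis using T True by (simp add: z_def weighting_def)
  qed (simp add: z_def)
  ultimately have "weighting P n z" by (simp add: weighting_def)
  then show thesis using eq by (rule that)
qed

text \<open>With all weights 1 the form reproduces the counts in \<open>G\<close>. Symmetrisation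
  then concentrates the weight on a clique, which has at most \<open>k - 1\<close> vertices and fits
  into \<open>P\<close>.\<close>

lemma blue_red_graph_le_multilin:
  assumes G: "simple_graph G" and free: "graph_free (complete_graph k) G" and k: "k \<ge> 1"
    and P: "finite P" "card P = k - 1"
  obtains c' z where "weighting P (int (card (verts G))) z"
    and "int (num_copies (complete_graph r) (colour_graph G c Blue))
         + int (card (edges (colour_graph G c Red))) - (t - 1) * int (card (edges (colour_graph G c Blue)))
         \<le> multilin P (weight r t c') z"
proof -
  let ?V = "verts G" and ?E = "edges G" and ?n = "int (card (verts G))"
  have V: "finite ?V" and E: "?E \<subseteq> {e. e \<subseteq> ?V \<and> card e = 2}" using G by (auto simp: simple_graph_def)
  define clq where "clq S \<longleftrightarrow> (\<forall>u\<in>S. \<forall>v\<in>S. u \<noteq> v \<longrightarrow> {u, v} \<in> ?E)" for S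
  \<comment> \<open>Cutting the coefficients down to cliques removes the mixed terms of non-adjacent
    vertices, as symmetrisation requires. On the final support, itself a clique, \<open>a\<close>
    agrees with \<open>weight r t c\<close>.\<close>
  define a where "a S = (if clq S then weight r t c S else 0)" for S
  have sb: "simple_graph (colour_graph G c Blue)"
    using G by (auto simp: simple_graph_def colour_graph_def)
  let ?N = "cliques r (colour_graph G c Blue)"
  let ?R = "edges (colour_graph G c Red)" and ?B = "edges (colour_graph G c Blue)"
  have ind: "(\<Sum>S\<in>Pow ?V. if S \<in> X then k else 0) = k * int (card X)" if "X \<subseteq> Pow ?V" for X and k :: int
  proof -
    have "(\<Sum>S\<in>Pow ?V. if S \<in> X then k else 0) = (\<Sum>S\<in>Pow ?V \<inter> X. k)"
      using V by (subst sum.inter_restrict) auto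
    then show ?thesis using that by (simp add: Int_absorb1)
  qed
  have sub: "?N \<subseteq> Pow ?V" "?R \<subseteq> Pow ?V" "?B \<subseteq> Pow ?V"
    using E by (auto simp: cliques_def colour_graph_def)
  have "a S = (if S \<in> ?N then 1 else 0) + ((if S \<in> ?R then 1 else 0) + (if S \<in> ?B then 1 - t else 0))"
    if "S \<subseteq> ?V" for S
  proof -
    have "S \<in> ?N \<longleftrightarrow> clq S \<and> card S = r \<and> blue_on c S"
      using that by (auto simp: cliques_def colour_graph_def clq_def blue_on_def)
    moreover have "S \<in> ?E \<longleftrightarrow> clq S \<and> card S = 2"
    proof
      assume "S \<in> ?E"
      moreover from this have "card S = 2" using E by auto
      ultimately show "clq S \<and> card S = 2" by (auto simp: clq_def card_2_iff insert_commute)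
    qed (auto simp: clq_def card_2_iff)
    then have "S \<in> ?R \<longleftrightarrow> clq S \<and> card S = 2 \<and> c S = Red" "S \<in> ?B \<longleftrightarrow> clq S \<and> card S = 2 \<and> c S = Blue"
      by (auto simp: colour_graph_def)
    moreover have "c S = Blue \<or> c S = Red" by (cases "c S") auto
    ultimately show ?thesis by (auto simp: a_def weight_def)
  qed
  then have "multilin ?V a (\<lambda>_. 1) = (\<Sum>S\<in>Pow ?V. (if S \<in> ?N then 1 else 0)
      + ((if S \<in> ?R then 1 else 0) + (if S \<in> ?B then 1 - t else 0)))"
    unfolding multilin_def by (intro sum.cong) auto
  also have "\<dots> = int (card ?N) + (int (card ?R) + (1 - t) * int (card ?B))"
    unfolding sum.distrib using ind[OF sub(1), of 1] ind[OF sub(2), of 1] ind[OF sub(3), of "1 - t"] by simp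
  also have "card ?N = num_copies (complete_graph r) (colour_graph G c Blue)"
    using sb by (simp add: num_copies_complete)
  finally have val: "multilin ?V a (\<lambda>_. 1) = int (num_copies (complete_graph r) (colour_graph G c Blue))
      + (int (card ?R) + (1 - t) * int (card ?B))" .
  have one: "weighting ?V ?n (\<lambda>_. 1)" by (simp add: weighting_def)
  have "a S = 0" if "u \<in> S" "v \<in> S" "u \<noteq> v" "{u, v} \<notin> ?E" for S u v
    using that by (auto simp: a_def clq_def)
  then obtain y where y: "weighting ?V ?n y" "multilin ?V a (\<lambda>_. 1) \<le> multilin ?V a y"
    and supp: "\<forall>u\<in>?V. \<forall>v\<in>?V. u \<noteq> v \<and> y u \<noteq> 0 \<and> y v \<noteq> 0 \<longrightarrow> {u, v} \<in> ?E"
    using clique_supported_weighting[OF V one, of ?E a] by blast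
  define T where "T = {u \<in> ?V. y u \<noteq> 0}"
  have T: "T \<subseteq> ?V" "finite T" using V by (auto simp: T_def)
  have clqT: "clq S" if "S \<subseteq> T" for S
    using that supp by (auto simp: clq_def T_def)
  have "card T \<le> k - 1"
  proof (rule ccontr)
    assume "\<not> card T \<le> k - 1"
    then have "k \<le> card T" by simp
    then obtain S where "S \<subseteq> T" "card S = k" by (rule obtain_subset_with_card_n)
    then have "S \<in> cliques k G" using clqT[of S] T by (auto simp: cliques_def clq_def)
    then show False using free graph_free_complete[OF G] by simp
  qed
  have "multilin ?V a y = multilin T a y" using V T by (intro multilin_superset) (auto simp: T_def)
  also have "\<dots> = multilin T (weight r t c) y"
    using T clqT by (intro multilin_cong) (auto simp: a_def)
  finally have eq: "multilin ?V a y = multilin T (weight r t c) y" .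
  have "sum y T = sum y ?V" using V by (intro sum.mono_neutral_left) (auto simp: T_def)
  then have wT: "weighting T ?n y" using y(1) T by (auto simp: weighting_def)
  have le: "card T \<le> card P" using \<open>card T \<le> k - 1\<close> P by simp
  obtain c' z where "weighting P ?n z" "multilin T (weight r t c) y = multilin P (weight r t c') z"
    by (rule weighting_transfer[OF wT T(2) P(1) le, of r t c]) (rule that)
  then show thesis using val eq y(2) by (intro that[of z c']) (simp_all add: algebra_simps)
qed

section \<open>Comparing the optimal blow-up with the extremal numbers\<close>

theorem theorem5:
  fixes G :: "'v graph" and c :: "'v set \<Rightarrow> colour"
    and r k n :: nat and t :: int
  assumes "r \<ge> 2" and "t \<ge> 1" and "k \<ge> 2"
    and "simple_graph G" and "card (verts G) = n"
    and "graph_free (complete_graph k) G"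
  shows "int (num_copies (complete_graph r) (colour_graph G c Blue))
           + t * int (card (edges (colour_graph G c Red)))
           + (t - 1) * (int (n choose 2) - int (card (edges G)))
         \<le> (t - 1) * int (n choose 2)
           + max (int (gen_ex_num n (complete_graph r) (complete_graph k))
                    - (t - 1) * int (ex_num n (complete_graph k)))
                 (int (ex_num n (complete_graph k)))"
proof -
  let ?P = "{..<k - 1}" and ?K = "complete_graph k"
  have k: "k \<ge> 1" using assms(3) by simp
  have P: "finite ?P" "?P \<noteq> {}" "card ?P = k - 1" "card ?P < k" using assms(3) by (auto simp: lessThan_empty_iff)
  obtain x where x: "weighting ?P (int n) x"
    and max2: "\<And>y. weighting ?P (int n) y \<Longrightarrow> esym 2 ?P y \<le> esym 2 ?P x"
    and bound: "\<And>c y. weighting ?P (int n) y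
       \<Longrightarrow> multilin ?P (weight r t c) y \<le> max (esym r ?P x - (t - 1) * esym 2 ?P x) (esym 2 ?P x)"
    by (rule multilin_weight_bound[OF P(1,2) _ assms(1,2), of "int n"]) (simp, rule that)
  obtain B :: "nat graph" where B: "simple_graph B" "card (verts B) = n" "graph_free ?K B"
    and num: "\<And>r. esym r ?P x \<le> int (num_copies (complete_graph r) B)"
    by (rule blowup_graph[OF x P(1,4)]) (rule that)
  have gen: "esym m ?P x \<le> int (gen_ex_num n (complete_graph m) ?K)" for m
    using num[of m] num_copies_le_gen_ex_num[OF B(1,3), of m] B(2) by simp
  \<comment> \<open>An edge-extremal graph, coloured all blue with \<open>r = 2\<close> and
    \<open>t = 1\<close>, gives the upper bound; the blow-up \<open>B\<close> gives the lower
    one.\<close>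
  have ex: "int (ex_num n ?K) = esym 2 ?P x"
  proof (rule antisym)
    obtain H :: "nat graph" where H: "simple_graph H" "card (verts H) = n" "graph_free ?K H"
      and exH: "ex_num n ?K = num_copies (complete_graph 2) H"
      using gen_ex_num_attained[OF B(1,3), of 2] B(2) by (metis ex_num_eq_gen_ex_num)
    obtain c' z where z: "weighting ?P (int n) z"
      and "int (num_copies (complete_graph 2) (colour_graph H (\<lambda>_. Blue) Blue))
         + int (card (edges (colour_graph H (\<lambda>_. Blue) Red)))
         - (1 - 1) * int (card (edges (colour_graph H (\<lambda>_. Blue) Blue))) \<le> multilin ?P (weight 2 1 c') z"
      by (rule blue_red_graph_le_multilin[OF H(1,3) k P(1,3), of 2 "\<lambda>_. Blue" 1, unfolded H(2)]) (rule that)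
    moreover have "colour_graph H (\<lambda>_. Blue) Blue = H" by (simp add: colour_graph_def)
    ultimately show "int (ex_num n ?K) \<le> esym 2 ?P x"
      using max2[OF z] exH by (simp add: multilin_weight_two_one)
    show "esym 2 ?P x \<le> int (ex_num n ?K)" using gen[of 2] by (simp add: ex_num_eq_gen_ex_num)
  qed
  obtain c' z where z: "weighting ?P (int n) z"
    and le: "int (num_copies (complete_graph r) (colour_graph G c Blue))
         + int (card (edges (colour_graph G c Red))) - (t - 1) * int (card (edges (colour_graph G c Blue)))
         \<le> multilin ?P (weight r t c') z"
    by (rule blue_red_graph_le_multilin[OF assms(4,6) k P(1,3), of r c t, unfolded assms(5)]) (rule that)
  \<comment> \<open>The edge term enters both with factor \<open>-(t - 1)\<close> and positively, so
    it is replaced by the equality \<open>ex\<close>; for the \<open>r\<close>-cliques the upper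
    bound \<open>gen\<close> suffices.\<close>
  have "multilin ?P (weight r t c') z
      \<le> max (int (gen_ex_num n (complete_graph r) ?K) - (t - 1) * int (ex_num n ?K)) (int (ex_num n ?K))"
    using bound[OF z, of c'] gen[of r] unfolding ex by linarith
  \<comment> \<open>Splitting the edges by colour turns the left side of the claim into the bounded
    quantity plus \<open>(t - 1) * (n choose 2)\<close>.\<close>
  moreover have "card (edges G) = card (edges (colour_graph G c Blue)) + card (edges (colour_graph G c Red))"
  proof -
    have "edges G \<subseteq> Pow (verts G)" "finite (verts G)" using assms(4) by (auto simp: simple_graph_def)
    then have fin: "finite (edges G)" using finite_subset by blast
    let ?b = "edges (colour_graph G c Blue)" and ?r = "edges (colour_graph G c Red)"
    have "finite ?b" "finite ?r" using fin by (simp_all add: colour_graph_def)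
    moreover have "?b \<inter> ?r = {}" by (auto simp: colour_graph_def)
    ultimately have "card (?b \<union> ?r) = card ?b + card ?r" by (rule card_Un_disjoint)
    moreover have "?b \<union> ?r = edges G" using colour.exhaust by (auto simp: colour_graph_def)
    ultimately show ?thesis by simp
  qed
  ultimately show ?thesis using le by (simp add: algebra_simps)
qed

end
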